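(* Let $\mathcal F$ be the collection of all non-empty subsets of $\mathbb N$, and let $N\ge 2$. All tournaments below have the finite set of nodes $X=\{x_1,\dots,x_n\}$ ($n\geq 2$), which is equipped with a topology. (i) Suppose that $n\geq 3$ and $T$ is a tournament on $X$, where $X$ carries an arbitrary topology. Then $T$ is $\mathcal F$-hypercyclic if and only if $T$ is strongly $\mathcal F$-hypercyclic. (ii) Suppose that $n\leq 4$ and $T_1,T_2,\dots,T_N$ are tournaments on $X$, where $X$ carries an arbitrary topology. Then $T_1,\dots,T_N$ are $d\mathcal F$-hypercyclic if and only if $T_1,\dots,T_N$ are strongly $d\mathcal F$-hypercyclic. (iii) Suppose that $n\geq 5$. Then there exist a topology on $X$ and tournaments $T_1,T_2,\dots,T_N$ on $X$ that are $d\mathcal F$-hypercyclic and not strongly $d\mathcal F$-hypercyclic.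
   Context: $\mathbb N=\{1,2,3,\dots\}$. A tournament on $X$ is given by a binary relation $\rho\subseteq X\times X$ (its set of arcs) without loops ($(x,x)\notin\rho$) such that for any two different nodes $x,y$ exactly one of $(x,y)$, $(y,x)$ belongs to $\rho$. Dynamical properties of a tournament are those of its relation $\rho$. For a relation $\rho$ on $X$, $\rho^n$ is the $n$-fold composition, $\rho^n x:=\{y:(x,y)\in\rho^n\}$, $D(\rho^n):=\{x:\rho^n x\ne\emptyset\}$, $D_\infty(\rho):=\bigcap_{n\in\mathbb N}D(\rho^n)$. $\rho$ is $\mathcal F$-hypercyclic if there is $x\in D_\infty(\rho)$ such that for every non-empty open $V\subseteq X$, $\{n\in\mathbb N:\rho^n x\cap V\neq\emptyset\}\in\mathcal F$. $\rho$ is strongly $\mathcal F$-hypercyclic if there are $x\in D_\infty(\rho)$ and elements $y_n\in\rho^n x$ ($n\in\mathbb N$) such that for every non-empty open $V\subseteq X$, $\{n\in\mathbb N:y_n\in V\}\in\mathcal F$. Relations $\rho_1,\dots,\rho_N$ on $X$ are $d\mathcal F$-hypercyclic if there is $x\in\bigcap_{j=1}^N D_\infty(\rho_j)$ such that for all non-empty open $V_1,\dots,V_N\subseteq X$, $\{n\in\mathbb N:\rho_j^n x\cap V_j\neq\emptyset\text{ for all }1\le j\le N\}\in\mathcal F$. They are strongly $d\mathcal F$-hypercyclic if there are $x\in X$ and elements $y_{j,n}\in\rho_j^n x$ ($1\le j\le N$, $n\in\mathbb N$) such that for all non-empty open $V_1,\dots,V_N\subseteq X$, $\{n\in\mathbb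 N:y_{j,n}\in V_j\text{ for all }1\le j\le N\}\in\mathcal F$. *)

theory Defs
  imports "HOL-Analysis.Abstract_Topology"
begin

(* The set of natural numbers is {1, 2, 3, ...} throughout; hence the bounds n >= 1, and the zeroth
   power rho ^^ 0 = Id never enters. The image rho^n x is (rho ^^ n) `` {x}, and D(rho^n) is
   Domain (rho ^^ n). The carrier of a topological space is topspace tau. *)

definition tournament_on :: "'a set \<Rightarrow> 'a rel \<Rightarrow> bool" where
  "tournament_on X \<rho> \<longleftrightarrow>
     \<rho> \<subseteq> X \<times> X \<and> (\<forall>x\<in>X. (x, x) \<notin> \<rho>) \<and>
     (\<forall>x\<in>X. \<forall>y\<in>X. x \<noteq> y \<longrightarrow> ((x, y) \<in> \<rho> \<longleftrightarrow> (y, x) \<notin> \<rho>))"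

definition D_inf :: "'a rel \<Rightarrow> 'a set" where
  "D_inf \<rho> = (\<Inter>n\<in>{1::nat..}. Domain (\<rho> ^^ n))"

definition hypercyclic :: "nat set set \<Rightarrow> 'a topology \<Rightarrow> 'a rel \<Rightarrow> bool" where
  "hypercyclic \<F> \<tau> \<rho> \<longleftrightarrow>
     (\<exists>x\<in>D_inf \<rho>. \<forall>V. openin \<tau> V \<and> V \<noteq> {} \<longrightarrow>
        {n. n \<ge> 1 \<and> (\<rho> ^^ n) `` {x} \<inter> V \<noteq> {}} \<in> \<F>)"

definition strongly_hypercyclic :: "nat set set \<Rightarrow> 'a topology \<Rightarrow> 'a rel \<Rightarrow> bool" where
  "strongly_hypercyclic \<F> \<tau> \<rho> \<longleftrightarrow>
     (\<exists>x\<in>D_inf \<rho>. \<exists>y :: nat \<Rightarrow> 'a.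
        (\<forall>n\<ge>1. y n \<in> (\<rho> ^^ n) `` {x}) \<and>
        (\<forall>V. openin \<tau> V \<and> V \<noteq> {} \<longrightarrow> {n. n \<ge> 1 \<and> y n \<in> V} \<in> \<F>))"

(* A tuple of relations rho_1, ..., rho_N is a function on nat, of which only the values at 1, ..., N
   are used; the same holds for tuples of open sets. *)

definition d_hypercyclic ::
    "nat set set \<Rightarrow> 'a topology \<Rightarrow> nat \<Rightarrow> (nat \<Rightarrow> 'a rel) \<Rightarrow> bool" where
  "d_hypercyclic \<F> \<tau> N \<rho> \<longleftrightarrow>
     (\<exists>x. (\<forall>j\<in>{1..N}. x \<in> D_inf (\<rho> j)) \<and>
        (\<forall>V :: nat \<Rightarrow> 'a set. (\<forall>j\<in>{1..N}. openin \<tau> (V j) \<and> V j \<noteq> {}) \<longrightarrow>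
           {n. n \<ge> 1 \<and> (\<forall>j\<in>{1..N}. (\<rho> j ^^ n) `` {x} \<inter> V j \<noteq> {})} \<in> \<F>))"

definition strongly_d_hypercyclic ::
    "nat set set \<Rightarrow> 'a topology \<Rightarrow> nat \<Rightarrow> (nat \<Rightarrow> 'a rel) \<Rightarrow> bool" where
  "strongly_d_hypercyclic \<F> \<tau> N \<rho> \<longleftrightarrow>
     (\<exists>x\<in>topspace \<tau>. \<exists>y :: nat \<Rightarrow> nat \<Rightarrow> 'a.
        (\<forall>j\<in>{1..N}. \<forall>n\<ge>1. y j n \<in> (\<rho> j ^^ n) `` {x}) \<and>
        (\<forall>V :: nat \<Rightarrow> 'a set. (\<forall>j\<in>{1..N}. openin \<tau> (V j) \<and> V j \<noteq> {}) \<longrightarrow>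
           {n. n \<ge> 1 \<and> (\<forall>j\<in>{1..N}. y j n \<in> V j)} \<in> \<F>))"

end

(* For the first two claims it suffices to choose distinct times for the finitely many targets (reachable
   nodes, resp. tuples of open sets): the value of y at a time then only has to serve one target. Targets
   that are met at infinitely many times cause no obstruction. For one tournament, the nodes v that are
   reached from x at finitely many times are separated by the last time at which they are reached, as any
   two nodes are joined by an arc. For at most four nodes, a point of D_inf forces a 3-cycle, and a
   nontrivial walk from it meets this cycle; so any meeting time n can be replaced by n + 3 k.
   For the third claim, take all tournaments equal, with a source x and a node u whose only predecessor
   is x, and the topology with the open sets {u} and its complement. At time 1 everything is reached, but
   u is reached at no other time, so the two tuples that start with {u} compete for time 1. *)

theory Submission
  imports Defs
begin

section \<open>Powers of a relation and the set \<open>D_inf\<close>\<close>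

lemma D_inf_iff: "x \<in> D_inf \<rho> \<longleftrightarrow> (\<forall>n\<ge>1. \<exists>y. (x, y) \<in> \<rho> ^^ n)"
  by (auto simp: D_inf_def Domain_iff)

lemma tournament_on_arc:
  assumes "tournament_on X T" "u \<in> X" "v \<in> X" "u \<noteq> v"
  shows "(u, v) \<in> T \<or> (v, u) \<in> T"
  using assms unfolding tournament_on_def by blast

lemma relpow_Suc_subset:
  assumes "T \<subseteq> X \<times> X"
  shows "T ^^ Suc n \<subseteq> X \<times> X"
proof (induction n)
  case 0
  then show ?case using assms by simp
next
  case (Suc n)
  then show ?case using assms by fastforce
qed

lemma relpow_subset:
  assumes "T \<subseteq> X \<times> X" "n \<ge> 1"
  shows "T ^^ n \<subseteq> X \<times> X"
  using assms relpow_Suc_subset[of T X "n - 1"] by simp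

section \<open>Distinct times for finitely many targets\<close>

text \<open>The set \<open>B\<close> of forbidden values drives the induction: the value picked for
  one index is added to it before the others are served. An infinite set always has a member outside
  a finite one.\<close>

lemma infinite_distinct_representatives:
  assumes "finite A" "finite B" "\<And>a. a \<in> A \<Longrightarrow> infinite (S a)"
  shows "\<exists>f. inj_on f A \<and> (\<forall>a\<in>A. f a \<in> S a - B)"
  using assms
proof (induction A arbitrary: B rule: finite_induct)
  case empty
  then show ?case by simp
next
  case (insert a A)
  obtain s where s: "s \<in> S a - B"
    using insert.prems by (metis finite_Diff2 finite.emptyI insertI1 ex_in_conv)
  obtain f where f: "inj_on f A" "\<forall>a\<in>A. f a \<in> S a - insert s B"
    using insert.IH[of "insert s B"] insert.prems by auto
  have "inj_on (f(a := s)) (insert a A)"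
    using f insert.hyps by (auto simp: inj_on_def)
  moreover have "\<forall>b\<in>insert a A. (f(a := s)) b \<in> S b - B"
    using f s by auto
  ultimately show ?case by blast
qed

text \<open>As \<open>f\<close> is injective, each time is assigned to at most one target, so the
  value at that time is chosen for this target alone. \<open>P\<close> says which values are
  admissible at a time, \<open>Q\<close> that a value meets a target.\<close>

lemma choice_meeting_targets:
  assumes inj: "inj_on f A"
    and meet: "\<And>a. a \<in> A \<Longrightarrow> \<exists>z. P (f a) z \<and> Q a z"
    and ex: "\<And>n. n \<in> D \<Longrightarrow> \<exists>z. P n z"
  shows "\<exists>y. (\<forall>n\<in>D. P n (y n)) \<and> (\<forall>a\<in>A. Q a (y (f a)))"
proof -
  have "\<exists>z. (n \<in> D \<longrightarrow> P n z) \<and> (\<forall>a\<in>A. f a = n \<longrightarrow> Q a z)" for n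
  proof (cases "n \<in> f ` A")
    case True
    then obtain a where a: "a \<in> A" "f a = n" by blast
    obtain z where "P (f a) z" "Q a z" using meet[OF a(1)] by blast
    moreover have "b = a" if "b \<in> A" "f b = n" for b
      using inj a that by (auto dest: inj_onD)
    ultimately show ?thesis using a by blast
  next
    case False
    then show ?thesis using ex by blast
  qed
  then show ?thesis by metis
qed

section \<open>A single tournament\<close>

lemma tournament_distinct_times:
  fixes x :: 'a
  assumes T: "tournament_on X T" and fin: "finite X"
  defines "R \<equiv> {v. \<exists>n\<ge>1. (x, v) \<in> T ^^ n}"
  shows "\<exists>f. inj_on f R \<and> (\<forall>v\<in>R. f v \<ge> 1 \<and> (x, v) \<in> T ^^ f v)"
proof -
  have TX: "T \<subseteq> X \<times> X" using T by (simp add: tournament_on_def)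
  have RX: "R \<subseteq> X" unfolding R_def using relpow_subset[OF TX] by blast
  then have finR: "finite R" using fin finite_subset by blast
  define S where "S v = {n. n \<ge> 1 \<and> (x, v) \<in> T ^^ n}" for v
  define F where "F = {v\<in>R. finite (S v)}"
  define L where "L v = Max (S v)" for v
  have LS: "L v \<in> S v" if "v \<in> F" for v
    unfolding L_def using that by (intro Max_in) (auto simp: F_def R_def S_def)
  \<comment> \<open>Following the arc from \<open>u\<close> to \<open>v\<close> after a walk of
    length \<open>L u\<close> reaches \<open>v\<close> one step later, so last times increase
    strictly along arcs.\<close>
  have L_less: "L u < L v" if "u \<in> F" "v \<in> F" "(u, v) \<in> T" for u v
  proof -
    have "Suc (L u) \<in> S v" using LS[OF that(1)] that(3) by (auto simp: S_def)
    moreover have "finite (S v)" using that(2) by (simp add: F_def)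
    ultimately have "Suc (L u) \<le> L v" unfolding L_def[of v] by (intro Max_ge)
    then show ?thesis by simp
  qed
  have injL: "inj_on L F"
  proof (rule inj_onI, rule ccontr)
    fix u v assume uv: "u \<in> F" "v \<in> F" "L u = L v" "u \<noteq> v"
    then have "(u, v) \<in> T \<or> (v, u) \<in> T"
      using tournament_on_arc[OF T] RX by (auto simp: F_def)
    then show False using L_less uv by fastforce
  qed
  \<comment> \<open>Nodes reached infinitely often have room to avoid all the times taken by
    \<open>F\<close>, which lets \<open>L\<close> and \<open>g\<close> be glued into one
    injection.\<close>
  obtain g where g: "inj_on g (R - F)" "\<forall>v\<in>R - F. g v \<in> S v - L ` F"
  proof -
    have "finite (R - F)" "finite (L ` F)" using finR by (auto simp: F_def)
    moreover have "infinite (S v)" if "v \<in> R - F" for v using that by (auto simp: F_def)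
    ultimately show ?thesis using infinite_distinct_representatives that by metis
  qed
  define f where "f v = (if v \<in> F then L v else g v)" for v
  have "inj_on f R"
  proof (rule inj_onI)
    fix u v assume uv: "u \<in> R" "v \<in> R" "f u = f v"
    have "g w \<notin> L ` F" if "w \<in> R - F" for w using g(2) that by blast
    then have "u \<in> F \<longleftrightarrow> v \<in> F" using uv by (metis DiffI f_def imageI)
    then show "u = v"
      using uv inj_onD[OF injL] inj_onD[OF g(1)] by (cases "u \<in> F") (auto simp: f_def)
  qed
  moreover have "\<forall>v\<in>R. f v \<in> S v"
    using LS g by (auto simp: f_def)
  ultimately show ?thesis unfolding S_def by blast
qed

text \<open>For this family, membership reduces to the existence of a single time, since the bound
  \<open>n \<ge> 1\<close> already gives the inclusion in \<open>{1..}\<close>.\<close>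

lemma nonempty_times_iff:
  "{n. n \<ge> 1 \<and> P n} \<in> {A. A \<subseteq> {1..} \<and> A \<noteq> {}} \<longleftrightarrow> (\<exists>n\<ge>1. P n)" for P :: "nat \<Rightarrow> bool"
  by auto

lemma strongly_hypercyclic_if_hypercyclic:
  assumes T: "tournament_on (topspace \<tau>) T" and fin: "finite (topspace \<tau>)"
    and hyp: "hypercyclic {A. A \<subseteq> {1..} \<and> A \<noteq> {}} \<tau> T"
  shows "strongly_hypercyclic {A. A \<subseteq> {1..} \<and> A \<noteq> {}} \<tau> T"
proof -
  obtain x where x: "x \<in> D_inf T"
    and meet: "\<And>V. openin \<tau> V \<Longrightarrow> V \<noteq> {} \<Longrightarrow> \<exists>n\<ge>1. (T ^^ n) `` {x} \<inter> V \<noteq> {}"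
    using hyp unfolding hypercyclic_def nonempty_times_iff by blast
  define R where "R = {v. \<exists>n\<ge>1. (x, v) \<in> T ^^ n}"
  obtain f where f: "inj_on f R" "\<forall>v\<in>R. f v \<ge> 1 \<and> (x, v) \<in> T ^^ f v"
    using tournament_distinct_times[OF T fin] unfolding R_def by blast
  \<comment> \<open>The targets here are all reachable nodes. A selection that visits each of them
    meets every non-empty open set, because such a set contains a reachable node.\<close>
  have "\<exists>y. (\<forall>n\<in>{1..}. (x, y n) \<in> T ^^ n) \<and> (\<forall>v\<in>R. y (f v) = v)"
    using f x by (intro choice_meeting_targets) (auto simp: D_inf_iff)
  then obtain y where y: "\<forall>n\<in>{1..}. (x, y n) \<in> T ^^ n" "\<forall>v\<in>R. y (f v) = v"
    by blast
  have "\<exists>n\<ge>1. y n \<in> V" if V: "openin \<tau> V" "V \<noteq> {}" for V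
  proof -
    obtain v where "v \<in> R" "v \<in> V" using meet[OF V] unfolding R_def by blast
    then show ?thesis using f(2) y(2) by metis
  qed
  then show ?thesis
    unfolding strongly_hypercyclic_def nonempty_times_iff using x y(1) by (intro bexI[of _ x] exI[of _ y]) auto
qed

lemma hypercyclic_if_strongly_hypercyclic:
  assumes "strongly_hypercyclic {A. A \<subseteq> {1..} \<and> A \<noteq> {}} \<tau> \<rho>"
  shows "hypercyclic {A. A \<subseteq> {1..} \<and> A \<noteq> {}} \<tau> \<rho>"
proof -
  obtain x y where x: "x \<in> D_inf \<rho>" and y: "\<forall>n\<ge>1. y n \<in> (\<rho> ^^ n) `` {x}"
    and meet: "\<forall>V. openin \<tau> V \<and> V \<noteq> {} \<longrightarrow> (\<exists>n\<ge>1. y n \<in> V)"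
    using assms unfolding strongly_hypercyclic_def nonempty_times_iff by (elim bexE exE conjE)
  have "\<exists>n\<ge>1. (\<rho> ^^ n) `` {x} \<inter> V \<noteq> {}" if V: "openin \<tau> V \<and> V \<noteq> {}" for V
  proof -
    obtain n where "n \<ge> 1" "y n \<in> V" using meet V by blast
    then show ?thesis using y by blast
  qed
  then show ?thesis
    unfolding hypercyclic_def nonempty_times_iff using x by blast
qed

section \<open>Tuples of relations, and tournaments with at most four nodes\<close>

lemma d_hypercyclic_if_strongly_d_hypercyclic:
  assumes "strongly_d_hypercyclic {A. A \<subseteq> {1..} \<and> A \<noteq> {}} \<tau> N \<rho>"
  shows "d_hypercyclic {A. A \<subseteq> {1..} \<and> A \<noteq> {}} \<tau> N \<rho>"
proof -
  obtain x y where y: "\<And>j n. j \<in> {1..N} \<Longrightarrow> n \<ge> 1 \<Longrightarrow> y j n \<in> (\<rho> j ^^ n) `` {x}"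
    and meet: "\<And>V. (\<forall>j\<in>{1..N}. openin \<tau> (V j) \<and> V j \<noteq> {}) \<Longrightarrow> \<exists>n\<ge>1. \<forall>j\<in>{1..N}. y j n \<in> V j"
    using assms unfolding strongly_d_hypercyclic_def nonempty_times_iff by blast
  have "x \<in> D_inf (\<rho> j)" if "j \<in> {1..N}" for j
    using y[OF that] by (auto simp: D_inf_iff)
  moreover have "\<exists>n\<ge>1. \<forall>j\<in>{1..N}. (\<rho> j ^^ n) `` {x} \<inter> V j \<noteq> {}"
    if "\<forall>j\<in>{1..N}. openin \<tau> (V j) \<and> V j \<noteq> {}" for V
    using meet[OF that] y by blast
  ultimately show ?thesis unfolding d_hypercyclic_def nonempty_times_iff by (intro exI[of _ x]) auto
qed

text \<open>Without a 3-cycle the tournament is transitive, hence acyclic. On a finite set the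
  lengths of walks from any node are then bounded, against the choice of \<open>x\<close>.\<close>

lemma tournament_three_cycle:
  assumes T: "tournament_on X T" and fin: "finite X" and x: "x \<in> D_inf T"
  shows "\<exists>a b c. (a, b) \<in> T \<and> (b, c) \<in> T \<and> (c, a) \<in> T"
proof (rule ccontr)
  assume no_cycle: "\<not> ?thesis"
  have TX: "T \<subseteq> X \<times> X" using T by (simp add: tournament_on_def)
  have irr: "(u, u) \<notin> T" for u using T by (auto simp: tournament_on_def)
  have asym: "(v, u) \<notin> T" if "(u, v) \<in> T" for u v
  proof -
    have uv: "u \<in> X" "v \<in> X" "u \<noteq> v" using that TX irr by auto
    moreover have "\<forall>u\<in>X. \<forall>v\<in>X. u \<noteq> v \<longrightarrow> ((u, v) \<in> T \<longleftrightarrow> (v, u) \<notin> T)"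
      using T unfolding tournament_on_def by (elim conjE)
    ultimately show ?thesis using that by metis
  qed
  have tr: "trans T"
  proof (rule transI)
    fix u v w assume uvw: "(u, v) \<in> T" "(v, w) \<in> T"
    then have "u \<noteq> w" using asym by blast
    then show "(u, w) \<in> T" using tournament_on_arc[OF T, of u w] no_cycle uvw TX by blast
  qed
  have "acyclic T"
    unfolding acyclic_def by (simp add: trancl_id[OF tr] irr)
  moreover have finT: "finite T" using TX fin by (meson finite_SigmaI finite_subset)
  ultimately have wf: "wf (T\<inverse>)" by (simp add: finite_acyclic_wf_converse)
  have "\<exists>n\<ge>1. \<forall>y. (z, y) \<notin> T ^^ n" for z
    using wf
  proof (induction z rule: wf_induct_rule)
    case (less z)
    have "finite (T `` {z})" using finT by (rule finite_Image)
    have "\<forall>w\<in>T `` {z}. \<exists>n. \<forall>y. (w, y) \<notin> T ^^ n" using less by blast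
    then obtain k where k: "\<And>w y. w \<in> T `` {z} \<Longrightarrow> (w, y) \<notin> T ^^ k w" by metis
    \<comment> \<open>The extra 0 keeps the maximum defined when \<open>z\<close> has no
      successor.\<close>
    define m where "m = Max (insert 0 (k ` (T `` {z})))"
    have km: "k w \<le> m" if "w \<in> T `` {z}" for w
      unfolding m_def using that \<open>finite (T `` {z})\<close> by (intro Max_ge) auto
    have "(z, y) \<notin> T ^^ Suc m" for y
    proof
      assume "(z, y) \<in> T ^^ Suc m"
      then obtain w where w: "(z, w) \<in> T" "(w, y) \<in> T ^^ m"
        by (meson relpow_Suc_E2)
      \<comment> \<open>The remaining walk has an initial part of length exactly \<open>k w\<close>,
        which is impossible from \<open>w\<close>.\<close>
      have "(w, y) \<in> T ^^ (k w + (m - k w))" using km w by simp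
      then show False using k w(1) unfolding relpow_add by blast
    qed
    then show ?case by (intro exI[of _ "Suc m"]) auto
  qed
  then show False using x unfolding D_inf_iff by blast
qed

lemma relpow_closed_walk_mult:
  assumes "(a, a) \<in> T ^^ p"
  shows "(a, a) \<in> T ^^ (p * k)"
proof (induction k)
  case (Suc k)
  then show ?case using assms by (auto simp: relpow_add)
qed simp

text \<open>At most one node lies off a given 3-cycle, and there are no loops. So one of the first
  two nodes of the walk is on the cycle, and \<open>k\<close> extra rounds can be inserted
  there.\<close>

lemma small_tournament_periodic_times:
  assumes T: "tournament_on X T" and fin: "finite X" and card: "card X \<le> 4"
    and x: "x \<in> D_inf T" and n: "n \<ge> 1" and walk: "(x, v) \<in> T ^^ n"
  shows "(x, v) \<in> T ^^ (n + 3 * k)"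
proof -
  have TX: "T \<subseteq> X \<times> X" using T by (simp add: tournament_on_def)
  have irr: "(u, u) \<notin> T" for u using T by (auto simp: tournament_on_def)
  have closed: "(d, d) \<in> T ^^ 3" if "(d, e) \<in> T" "(e, f) \<in> T" "(f, d) \<in> T" for d e f
    using that by (auto simp: numeral_3_eq_3)
  obtain a b c where abc: "(a, b) \<in> T" "(b, c) \<in> T" "(c, a) \<in> T"
    using tournament_three_cycle[OF T fin x] by blast
  have cyc: "(w, w) \<in> T ^^ 3" if "w \<in> {a, b, c}" for w
    using that closed abc by blast
  have insert: "(x, v) \<in> T ^^ (n + 3 * k)"
    if "(x, w) \<in> T ^^ i" "(w, v) \<in> T ^^ j" "i + j = n" "w \<in> {a, b, c}" for w i j
  proof -
    have "(w, w) \<in> T ^^ (3 * k)" by (rule relpow_closed_walk_mult[OF cyc[OF that(4)]])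
    then have "(x, v) \<in> T ^^ (i + 3 * k + j)"
      using that(1,2) unfolding relpow_add by (intro relcompI)
    moreover have "i + 3 * k + j = n + 3 * k" using that(3) by simp
    ultimately show ?thesis by simp
  qed
  obtain m where m: "n = Suc m" using n by (cases n) auto
  obtain w where w: "(x, w) \<in> T" "(w, v) \<in> T ^^ m"
    using walk unfolding m by (meson relpow_Suc_E2)
  have "x \<in> {a, b, c} \<or> w \<in> {a, b, c}"
  proof (rule ccontr)
    assume "\<not> ?thesis"
    then have "card {a, b, c, x, w} = 5" using abc w irr by (auto simp: card_insert_if)
    moreover have "card {a, b, c, x, w} \<le> card X"
      using abc w TX fin by (intro card_mono) auto
    ultimately show False using card by simp
  qed
  then show ?thesis
    \<comment> \<open>The rounds are inserted after 0 steps or after 1 step.\<close>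
    using insert[of x 0 n] insert[of w 1 m] walk w m by auto
qed

lemma strongly_d_hypercyclic_if_d_hypercyclic:
  assumes T: "\<forall>j\<in>{1..N}. tournament_on (topspace \<tau>) (T j)" and N: "N \<ge> 1"
    and fin: "finite (topspace \<tau>)" and card: "card (topspace \<tau>) \<le> 4"
    and hyp: "d_hypercyclic {A. A \<subseteq> {1..} \<and> A \<noteq> {}} \<tau> N T"
  shows "strongly_d_hypercyclic {A. A \<subseteq> {1..} \<and> A \<noteq> {}} \<tau> N T"
proof -
  obtain x where x: "\<And>j. j \<in> {1..N} \<Longrightarrow> x \<in> D_inf (T j)"
    and meet: "\<And>V. (\<forall>j\<in>{1..N}. openin \<tau> (V j) \<and> V j \<noteq> {}) \<Longrightarrow>
      \<exists>n\<ge>1. \<forall>j\<in>{1..N}. (T j ^^ n) `` {x} \<inter> V j \<noteq> {}"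
    using hyp unfolding d_hypercyclic_def nonempty_times_iff by blast
  \<comment> \<open>The first tournament has an arc out of \<open>x\<close>, which places
    \<open>x\<close> in the carrier.\<close>
  have x_in: "x \<in> topspace \<tau>"
  proof -
    have "x \<in> D_inf (T 1)" "T 1 \<subseteq> topspace \<tau> \<times> topspace \<tau>"
      using x[of 1] T N by (auto simp: tournament_on_def)
    moreover from this(1) have "\<exists>y. (x, y) \<in> T 1 ^^ 1" unfolding D_inf_iff by blast
    ultimately show ?thesis by auto
  qed
  \<comment> \<open>Extensional functions leave only finitely many tuples; an arbitrary
    \<open>V\<close> is later restricted to \<open>{1..N}\<close> to fit in.\<close>
  define A where "A = {1..N} \<rightarrow>\<^sub>E {V. openin \<tau> V \<and> V \<noteq> {}}"
  define S where "S V = {n. n \<ge> 1 \<and> (\<forall>j\<in>{1..N}. (T j ^^ n) `` {x} \<inter> V j \<noteq> {})}"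
    for V :: "nat \<Rightarrow> 'a set"
  have "finite {V. openin \<tau> V \<and> V \<noteq> {}}"
    by (rule finite_subset[of _ "Pow (topspace \<tau>)"]) (use fin openin_subset in auto)
  then have finA: "finite A" unfolding A_def by (intro finite_PiE) auto
  have infS: "infinite (S V)" if "V \<in> A" for V
  proof -
    have "\<forall>j\<in>{1..N}. openin \<tau> (V j) \<and> V j \<noteq> {}" using that by (auto simp: A_def)
    from meet[OF this] obtain n where n: "n \<ge> 1" "\<forall>j\<in>{1..N}. (T j ^^ n) `` {x} \<inter> V j \<noteq> {}"
      by blast
    \<comment> \<open>The 3-cycles may differ from one \<open>T j\<close> to another, but the shift
      is the same for all \<open>j\<close>, so a simultaneous meeting is preserved.\<close>
    have "n + 3 * k \<in> S V" for k
    proof -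
      have "(T j ^^ (n + 3 * k)) `` {x} \<inter> V j \<noteq> {}" if j: "j \<in> {1..N}" for j
      proof -
        obtain v where v: "(x, v) \<in> T j ^^ n" "v \<in> V j" using n j by blast
        have "(x, v) \<in> T j ^^ (n + 3 * k)"
          using small_tournament_periodic_times[OF _ fin card x[OF j] n(1) v(1)] T j by blast
        then show ?thesis using v by blast
      qed
      then show ?thesis using n by (auto simp: S_def)
    qed
    then have "range (\<lambda>k. n + 3 * k) \<subseteq> S V" by blast
    moreover have "infinite (range (\<lambda>k. n + 3 * k))"
      by (intro range_inj_infinite) (auto simp: inj_on_def)
    ultimately show ?thesis using finite_subset by blast
  qed
  obtain f where f: "inj_on f A" "\<forall>V\<in>A. f V \<in> S V"
    using infinite_distinct_representatives[of A "{}" S] finA infS by auto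
  have ex: "\<exists>z. \<forall>j\<in>{1..N}. (x, z j) \<in> T j ^^ n" if "n \<in> {1..}" for n
    using x that by (intro bchoice) (auto simp: D_inf_iff)
  have target: "\<exists>z. (\<forall>j\<in>{1..N}. (x, z j) \<in> T j ^^ f V) \<and> (\<forall>j\<in>{1..N}. z j \<in> V j)" if "V \<in> A" for V
  proof -
    have "\<forall>j\<in>{1..N}. \<exists>z. (x, z) \<in> T j ^^ f V \<and> z \<in> V j"
      using f(2) that by (fastforce simp: S_def)
    from bchoice[OF this] show ?thesis by blast
  qed
  \<comment> \<open>The selected values are whole tuples: all coordinates at one time are chosen
    together.\<close>
  obtain y where y: "\<forall>n\<in>{1..}. \<forall>j\<in>{1..N}. (x, y n j) \<in> T j ^^ n"
    "\<forall>V\<in>A. \<forall>j\<in>{1..N}. y (f V) j \<in> V j"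
    using choice_meeting_targets[where P = "\<lambda>n z. \<forall>j\<in>{1..N}. (x, z j) \<in> T j ^^ n"
        and Q = "\<lambda>V z. \<forall>j\<in>{1..N}. z j \<in> V j" and D = "{1..}", OF f(1) target ex] by blast
  have "\<exists>n\<ge>1. \<forall>j\<in>{1..N}. y n j \<in> V j"
    if V: "\<forall>j\<in>{1..N}. openin \<tau> (V j) \<and> V j \<noteq> {}" for V
  proof -
    let ?W = "restrict V {1..N}"
    have W: "?W \<in> A" using V by (auto simp: A_def)
    then have "f ?W \<ge> 1" "\<forall>j\<in>{1..N}. y (f ?W) j \<in> V j"
      using f(2) y(2) by (fastforce simp: S_def)+
    then show ?thesis by blast
  qed
  then show ?thesis
    unfolding strongly_d_hypercyclic_def nonempty_times_iff using x_in y(1)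
    by (intro bexI[of _ x] exI[of _ "\<lambda>j n. y n j"]) auto
qed

section \<open>A counterexample on five or more nodes\<close>

text \<open>Five nodes suffice: the source \<open>x\<close>, the node \<open>u\<close>, and a
  3-cycle on which walks from \<open>x\<close> continue forever. The numbering \<open>h\<close>
  gives them the numbers 0 to 4, and \<open>a\<close> is the node numbered 2.\<close>

lemma exists_tournament_unique_predecessor:
  assumes fin: "finite X" and card: "card X \<ge> 5"
  shows "\<exists>T x u a. tournament_on X T \<and> x \<in> D_inf T \<and> {x, u, a} \<subseteq> X \<and> a \<noteq> u \<and>
    (x, u) \<in> T \<and> (x, a) \<in> T \<and> (\<forall>v. (v, x) \<notin> T) \<and> (\<forall>v. (v, u) \<in> T \<longrightarrow> v = x)"
proof -
  obtain h where h: "bij_betw h X {0..<card X}"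
    using ex_bij_betw_finite_nat[OF fin] by blast
  define g where "g = inv_into X h"
  have gX: "g i \<in> X" and hg: "h (g i) = i" if "i < 5" for i
  proof -
    have "i \<in> h ` X" using h that card by (auto simp: bij_betw_def)
    then show "g i \<in> X" "h (g i) = i" by (auto simp: g_def inv_into_into f_inv_into_f)
  qed
  have inj: "p = q" if "p \<in> X" "q \<in> X" "h p = h q" for p q
    using h that by (auto simp: bij_betw_def dest: inj_onD)
  (* The transitive tournament with the arc from 2 to 4 reversed, which creates the cycle 2, 3, 4. *)
  define T where "T = {(p, q) \<in> X \<times> X.
    h p < h q \<and> \<not> (h p = 2 \<and> h q = 4) \<or> h p = 4 \<and> h q = 2}"
  have tour: "tournament_on X T"
    unfolding tournament_on_def
  proof (intro conjI ballI impI)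
    fix p q assume "p \<in> X" "q \<in> X" "p \<noteq> q"
    then have "h p \<noteq> h q" using inj by blast
    then show "(p, q) \<in> T \<longleftrightarrow> (q, p) \<notin> T"
      using \<open>p \<in> X\<close> \<open>q \<in> X\<close> by (auto simp: T_def)
  qed (auto simp: T_def)
  have arcs: "(g 0, g 1) \<in> T" "(g 0, g 2) \<in> T" "(g 2, g 3) \<in> T" "(g 3, g 4) \<in> T" "(g 4, g 2) \<in> T"
    using gX hg by (auto simp: T_def)
  \<comment> \<open>A walk enters the cycle with its first step and can stay on it.\<close>
  have "\<exists>v\<in>{g 2, g 3, g 4}. (g 0, v) \<in> T ^^ Suc n" for n
  proof (induction n)
    case 0
    then show ?case using arcs by auto
  next
    case (Suc n)
    then obtain v where v: "v \<in> {g 2, g 3, g 4}" "(g 0, v) \<in> T ^^ Suc n" by blast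
    obtain w where "w \<in> {g 2, g 3, g 4}" "(v, w) \<in> T" using v(1) arcs by blast
    then show ?case using v(2) by (metis relpow_Suc_I)
  qed
  then have "\<exists>y. (g 0, y) \<in> T ^^ n" if "n \<ge> 1" for n
    using that by (metis Suc_pred' less_eq_Suc_le One_nat_def)
  then have D: "g 0 \<in> D_inf T" by (simp add: D_inf_iff)
  have source: "\<forall>v. (v, g 0) \<notin> T" using hg[of 0] by (auto simp: T_def)
  have pred: "\<forall>v. (v, g 1) \<in> T \<longrightarrow> v = g 0"
  proof (intro allI impI)
    fix v assume "(v, g 1) \<in> T"
    then have "v \<in> X" "h v = h (g 0)" using hg[of 0] hg[of 1] by (auto simp: T_def)
    then show "v = g 0" using inj gX[of 0] by simp
  qed
  have "g 2 \<noteq> g 1" using hg[of 1] hg[of 2] by auto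
  moreover have "{g 0, g 1, g 2} \<subseteq> X" using gX by simp
  ultimately have "tournament_on X T \<and> g 0 \<in> D_inf T \<and> {g 0, g 1, g 2} \<subseteq> X \<and> g 2 \<noteq> g 1 \<and>
    (g 0, g 1) \<in> T \<and> (g 0, g 2) \<in> T \<and> (\<forall>v. (v, g 0) \<notin> T) \<and> (\<forall>v. (v, g 1) \<in> T \<longrightarrow> v = g 0)"
    using tour D arcs(1,2) source pred by (intro conjI)
  then show ?thesis by (intro exI)
qed

lemma relpow_to_source:
  fixes T :: "'a rel"
  assumes "\<forall>v. (v, x) \<notin> T" "(z, x) \<in> T ^^ n"
  shows "n = 0"
proof (cases n)
  case (Suc m)
  then have "(z, x) \<in> T ^^ Suc m" using assms(2) by simp
  then obtain w where "(w, x) \<in> T" by (blast elim: relpow_Suc_E)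
  then show ?thesis using assms(1) by blast
qed

lemma d_hypercyclic_not_strongly_d_hypercyclic:
  assumes fin: "finite X" and card: "card X \<ge> 5" and N: "N \<ge> 2"
  shows "\<exists>\<tau> T. topspace \<tau> = X \<and> tournament_on X T \<and>
    d_hypercyclic {A. A \<subseteq> {1..} \<and> A \<noteq> {}} \<tau> N (\<lambda>_. T) \<and>
    \<not> strongly_d_hypercyclic {A. A \<subseteq> {1..} \<and> A \<noteq> {}} \<tau> N (\<lambda>_. T)"
proof -
  obtain T x u a where T: "tournament_on X T" "x \<in> D_inf T" "{x, u, a} \<subseteq> X" "a \<noteq> u"
    "(x, u) \<in> T" "(x, a) \<in> T" "\<forall>v. (v, x) \<notin> T" "\<forall>v. (v, u) \<in> T \<longrightarrow> v = x"
    using exists_tournament_unique_predecessor[OF fin card] by blast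
  define W where "W = X - {u}"
  \<comment> \<open>An open set contains all of \<open>W\<close> or none of it, so the blocks
    \<open>{u}\<close> and \<open>W\<close> generate the topology.\<close>
  define op where "op S \<longleftrightarrow> S \<subseteq> X \<and> (\<forall>p\<in>W. \<forall>q\<in>W. p \<in> S \<longrightarrow> q \<in> S)" for S
  have "istopology op" unfolding istopology_def op_def by blast
  then have op: "openin (topology op) = op" by (rule topology_inverse')
  have op_X: "op X" and op_u: "op {u}" and op_W: "op W"
    using T(3) by (auto simp: op_def W_def)
  have top: "topspace (topology op) = X"
  proof
    show "topspace (topology op) \<subseteq> X" unfolding topspace_def op by (auto simp: op_def)
    show "X \<subseteq> topspace (topology op)" using op_X openin_subset[of "topology op" X] by (simp add: op)
  qed
  \<comment> \<open>A walk to \<open>u\<close> passes through \<open>x\<close> just before, and only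
    the walk of length 0 ends at the source. The start \<open>z\<close> is arbitrary because the
    strong notion may use any starting node.\<close>
  have time: "n = 1" if u: "(z, u) \<in> T ^^ n" and n: "n \<ge> 1" for z n
  proof -
    obtain m where m: "n = Suc m" using n by (cases n) auto
    obtain w where "(z, w) \<in> T ^^ m" "(w, u) \<in> T" using u unfolding m by (rule relpow_Suc_E)
    then have "(z, x) \<in> T ^^ m" using T(8) by blast
    then show ?thesis using relpow_to_source[OF T(7)] m by simp
  qed
  \<comment> \<open>A non-empty open set contains \<open>u\<close> or the whole of \<open>W\<close>,
    hence \<open>a\<close>; both nodes are successors of \<open>x\<close>.\<close>
  have first: "(T ^^ 1) `` {x} \<inter> S \<noteq> {}" if S: "op S" "S \<noteq> {}" for S
  proof (cases "u \<in> S")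
    case True
    then show ?thesis using T(5) by auto
  next
    case False
    then obtain p where "p \<in> S" "p \<in> W" using S by (auto simp: op_def W_def)
    moreover have "a \<in> W" using T(3,4) by (auto simp: W_def)
    ultimately have "a \<in> S" using S(1) by (auto simp: op_def)
    then show ?thesis using T(6) by auto
  qed
  have "d_hypercyclic {A. A \<subseteq> {1..} \<and> A \<noteq> {}} (topology op) N (\<lambda>_. T)"
    unfolding d_hypercyclic_def nonempty_times_iff op
    using T(2) first by (intro exI[of _ x] conjI allI impI exI[of _ 1]) auto
  moreover have "\<not> strongly_d_hypercyclic {A. A \<subseteq> {1..} \<and> A \<noteq> {}} (topology op) N (\<lambda>_. T)"
  proof
    assume "strongly_d_hypercyclic {A. A \<subseteq> {1..} \<and> A \<noteq> {}} (topology op) N (\<lambda>_. T)"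
    then obtain z y where y: "\<And>j n. j \<in> {1..N} \<Longrightarrow> n \<ge> 1 \<Longrightarrow> (z, y j n) \<in> T ^^ n"
      and meet: "\<And>V. (\<forall>j\<in>{1..N}. op (V j) \<and> V j \<noteq> {}) \<Longrightarrow> \<exists>n\<ge>1. \<forall>j\<in>{1..N}. y j n \<in> V j"
      unfolding strongly_d_hypercyclic_def nonempty_times_iff op by blast
    have one: "n = 1" if "y 1 n = u" "n \<ge> 1" for n
      using time[of z n] y[of 1 n] that N by simp
    obtain n where n: "n \<ge> 1" "\<forall>j\<in>{1..N}. y j n \<in> {u}"
      using meet[of "\<lambda>_. {u}"] op_u by auto
    have "W \<noteq> {}" using T(3,4) by (auto simp: W_def)
    \<comment> \<open>Both this tuple and the constant tuple \<open>{u}\<close> have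
      \<open>{u}\<close> in the first coordinate, so both must be met at time 1. There the second
      coordinate would have to be \<open>u\<close> and also lie in \<open>W\<close>.\<close>
    then have "\<forall>j\<in>{1..N}. op (if j = 1 then {u} else W) \<and> (if j = 1 then {u} else W) \<noteq> {}"
      using op_u op_W by simp
    from meet[OF this] obtain m
      where m: "m \<ge> 1" "\<forall>j\<in>{1..N}. y j m \<in> (if j = 1 then {u} else W)"
      by blast
    have "y 1 n = u" "y 2 n = u" using n N by auto
    moreover have "y 1 m = u" "y 2 m \<in> W" using bspec[OF m(2), of 1] bspec[OF m(2), of 2] N by auto
    ultimately show False using one n(1) m(1) by (auto simp: W_def)
  qed
  ultimately show ?thesis using top T(1) by blast
qed

theorem theorem3p17:
  fixes X :: "'a set" and n N :: nat and \<F> :: "nat set set"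
  assumes F_def: "\<F> = {A. A \<subseteq> {1..} \<and> A \<noteq> {}}"
    and N: "N \<ge> 2"
    and X: "finite X" "card X = n"
    and n: "n \<ge> 2"
  shows
    "(n \<ge> 3 \<longrightarrow>
       (\<forall>\<tau> T. topspace \<tau> = X \<and> tournament_on X T \<longrightarrow>
          (hypercyclic \<F> \<tau> T \<longleftrightarrow> strongly_hypercyclic \<F> \<tau> T))) \<and>
     (n \<le> 4 \<longrightarrow>
       (\<forall>\<tau> T. topspace \<tau> = X \<and> (\<forall>j\<in>{1..N}. tournament_on X (T j)) \<longrightarrow>
          (d_hypercyclic \<F> \<tau> N T \<longleftrightarrow> strongly_d_hypercyclic \<F> \<tau> N T))) \<and>
     (n \<ge> 5 \<longrightarrow>
       (\<exists>\<tau> T. topspace \<tau> = X \<and> (\<forall>j\<in>{1..N}. tournament_on X (T j)) \<and>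
          d_hypercyclic \<F> \<tau> N T \<and> \<not> strongly_d_hypercyclic \<F> \<tau> N T))"
proof (intro conjI impI allI)
  fix \<tau> T assume "topspace \<tau> = X \<and> tournament_on X T"
  then show "hypercyclic \<F> \<tau> T \<longleftrightarrow> strongly_hypercyclic \<F> \<tau> T"
    unfolding F_def
    using strongly_hypercyclic_if_hypercyclic[of \<tau> T] X(1)
      hypercyclic_if_strongly_hypercyclic[of \<tau> T] by blast
next
  fix \<tau> T assume "n \<le> 4" "topspace \<tau> = X \<and> (\<forall>j\<in>{1..N}. tournament_on X (T j))"
  moreover from this have "finite (topspace \<tau>)" "card (topspace \<tau>) \<le> 4" "N \<ge> 1"
    using X N by simp_all
  ultimately show "d_hypercyclic \<F> \<tau> N T \<longleftrightarrow> strongly_d_hypercyclic \<F> \<tau> N T"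
    unfolding F_def
    using strongly_d_hypercyclic_if_d_hypercyclic[of N \<tau> T]
      d_hypercyclic_if_strongly_d_hypercyclic[of \<tau> N T] by blast
next
  assume "n \<ge> 5"
  then obtain \<tau> T where "topspace \<tau> = X" "tournament_on X T"
    "d_hypercyclic \<F> \<tau> N (\<lambda>_. T)" "\<not> strongly_d_hypercyclic \<F> \<tau> N (\<lambda>_. T)"
    using d_hypercyclic_not_strongly_d_hypercyclic[OF X(1) _ N] X(2) unfolding F_def by blast
  then show "\<exists>\<tau> T. topspace \<tau> = X \<and> (\<forall>j\<in>{1..N}. tournament_on X (T j)) \<and>
      d_hypercyclic \<F> \<tau> N T \<and> \<not> strongly_d_hypercyclic \<F> \<tau> N T"
    by (intro exI[of _ \<tau>] exI[of _ "\<lambda>_. T"]) blast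
qed

end
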